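(* There is an order embedding of $\mathcal{P}(\omega)/\mathrm{Fin}$, ordered by $\subseteq^*$, into the family of Borel (in fact $\mathbf{\Sigma}^0_4$) ideals of the form $\mathcal{I}(\mathcal{F})$ which are in-between the ideals $\mathcal{ED}$ and $\mathrm{Fin}\otimes\mathrm{Fin}$, ordered by the Katětov (or equivalently Katětov–Blass) order. That is, to each $A\subseteq\omega$ one can assign a nonempty family $\mathcal{F}^A\subseteq\omega^\omega$ such that each ideal $\mathcal{I}(\mathcal{F}^A)$ is $\mathbf{\Sigma}^0_4$, $\mathcal{ED}\leq_K\mathcal{I}(\mathcal{F}^A)\leq_K\mathrm{Fin}\otimes\mathrm{Fin}$, and for all $A,B\subseteq\omega$: $A\subseteq^* B \iff \mathcal{I}(\mathcal{F}^A)\leq_K\mathcal{I}(\mathcal{F}^B)\iff \mathcal{I}(\mathcal{F}^A)\leq_{KB}\mathcal{I}(\mathcal{F}^B)$. In particular: (1) there is a $\leq_K$-antichain (a family of pairwise $\leq_K$-incomparable ideals) of cardinality $\mathfrak{c}$ consisting of Borel ideals of the form $\mathcal{I}(\mathcal{F})$ (in particular, there are $\mathfrak{c}$ pairwise nonisomorphic Borel ideals of the form $\mathcal{I}(\mathcal{F})$); (2) there are (strictly) increasing and (strictly) decreasing $\leq_{KB}$-chains of length $\mathfrak{b}$ of Borel ideals of the form $\mathcal{I}(\mathcal{F})$.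
   Context: An ideal on a countable infinite set $X$ is a family $\mathcal{I}\subseteq\mathcal{P}(X)$ closed under subsets and finite unions, containing all finite subsets of $X$, with $X\notin\mathcal{I}$. Topological notions for ideals refer to $\mathcal{P}(X)$ identified with $2^X$ (product topology). $\forall^\infty n$ means "for all but finitely many $n$". For $A\subseteq\omega\times\omega$, $A_{(n)}=\{k:(n,k)\in A\}$. For nonempty $\mathcal{F}\subseteq\omega^\omega$, $\mathcal{I}(\mathcal{F})$ is the ideal on $\omega\times\omega$ generated by $\{A\subseteq\omega\times\omega:\exists f\in\mathcal{F}\,\forall^\infty n\,(|A_{(n)}|\leq f(n))\}$ (i.e. all subsets of finite unions of members of this family). $\mathcal{ED}=\{A\subseteq\omega\times\omega:\exists m\,\forall^\infty n\,(|A_{(n)}|<m)\}$; $\mathrm{Fin}\otimes\mathrm{Fin}=\{A\subseteq\omega\times\omega:\forall^\infty n\,(|A_{(n)}|<\aleph_0)\}$. For ideals $\mathcal{I}$ on $X$ and $\mathcal{J}$ on $Y$: $\mathcal{I}\leq_K\mathcal{J}$ (Katětov order) if there is $f:Y\to X$ with $f^{-1}[A]\in\mathcal{J}$ for every $A\in\mathcal{I}$; $\mathcal{I}\leq_{KB}\mathcal{J}$ (Katětov–Blass order) if such an $f$ can be chosen finite-to-one; $\mathcal{I}$ and $\mathcal{J}$ are isomorphic if there is a bijection $f:X\to Y$ with $A\in\mathcal{I}\iff f[A]\in\mathcal{J}$ for all $A\subseteq X$. $A\subseteq^* B$ means $A\setminus B$ is finite. $\mathfrak{b}$ is the bounding number: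 the least cardinality of an unbounded subset of $(\omega^\omega,\leq^* )$, where $f\leq^* g$ iff $\forall^\infty n\,(f(n)\leq g(n))$. $\mathfrak{c}=2^{\aleph_0}$. *)

theory Defs
  imports "HOL-Analysis.Analysis"
begin

unbundle cardinal_syntax

section \<open>Ideals\<close>

text \<open>Ideals live on a whole (countably infinite) type; below the type is \<^typ>\<open>nat \<times> nat\<close>.\<close>

definition is_ideal :: "'a set set \<Rightarrow> bool" where
  "is_ideal \<I> \<longleftrightarrow>
     (\<forall>A\<in>\<I>. \<forall>B. B \<subseteq> A \<longrightarrow> B \<in> \<I>) \<and>
     (\<forall>A\<in>\<I>. \<forall>B\<in>\<I>. A \<union> B \<in> \<I>) \<and>
     (\<forall>A. finite A \<longrightarrow> A \<in> \<I>) \<and>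
     UNIV \<notin> \<I>"

definition katetov_le :: "'a set set \<Rightarrow> 'b set set \<Rightarrow> bool" (infix "\<le>\<^sub>K" 50) where
  "\<I> \<le>\<^sub>K \<J> \<longleftrightarrow> (\<exists>f :: 'b \<Rightarrow> 'a. \<forall>A\<in>\<I>. f -` A \<in> \<J>)"

definition katetov_blass_le :: "'a set set \<Rightarrow> 'b set set \<Rightarrow> bool" (infix "\<le>\<^sub>K\<^sub>B" 50) where
  "\<I> \<le>\<^sub>K\<^sub>B \<J> \<longleftrightarrow>
     (\<exists>f :: 'b \<Rightarrow> 'a. (\<forall>x. finite (f -` {x})) \<and> (\<forall>A\<in>\<I>. f -` A \<in> \<J>))"

definition ideal_isomorphic :: "'a set set \<Rightarrow> 'b set set \<Rightarrow> bool" where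
  "ideal_isomorphic \<I> \<J> \<longleftrightarrow>
     (\<exists>f :: 'a \<Rightarrow> 'b. bij f \<and> (\<forall>A. A \<in> \<I> \<longleftrightarrow> f ` A \<in> \<J>))"

section \<open>Descriptive complexity\<close>

text \<open>The finite levels of the Borel hierarchy; level \<open>0\<close> is junk.\<close>

fun Sigma0 :: "nat \<Rightarrow> 'a::topological_space set set" where
  "Sigma0 0 = {}"
| "Sigma0 (Suc 0) = {U. open U}"
| "Sigma0 (Suc (Suc n)) = {(\<Union>i. B i) | B :: nat \<Rightarrow> 'a set. \<forall>i. - B i \<in> Sigma0 (Suc n)}"

text \<open>The power set of \<open>'a\<close> is identified with \<open>'a \<Rightarrow> bool\<close>, which carries the product of the
  discrete topologies: \<open>Collect -` \<I>\<close> is the set of characteristic functions of members of \<open>\<I>\<close>.\<close>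

definition Sigma0_ideal :: "nat \<Rightarrow> 'a set set \<Rightarrow> bool" where
  "Sigma0_ideal n \<I> \<longleftrightarrow> is_ideal \<I> \<and> Collect -` \<I> \<in> Sigma0 n"

definition Borel_ideal :: "'a set set \<Rightarrow> bool" where
  "Borel_ideal \<I> \<longleftrightarrow> is_ideal \<I> \<and> Collect -` \<I> \<in> sets borel"

section \<open>The ideals on \<open>\<omega> \<times> \<omega>\<close>\<close>

text \<open>The section \<open>A\<^sub>(\<^sub>n\<^sub>)\<close> is \<open>A `` {n}\<close>. Since \<^const>\<open>card\<close> is \<open>0\<close> on infinite sets, finiteness of
  sections has to be demanded separately.\<close>

definition ED :: "(nat \<times> nat) set set" where
  "ED = {A. \<exists>m. \<forall>\<^sub>\<infinity>n. finite (A `` {n}) \<and> card (A `` {n}) < m}"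

definition FinFin :: "(nat \<times> nat) set set" where
  "FinFin = {A. \<forall>\<^sub>\<infinity>n. finite (A `` {n})}"

definition family_generators :: "(nat \<Rightarrow> nat) set \<Rightarrow> (nat \<times> nat) set set" where
  "family_generators \<F> = {A. \<exists>f\<in>\<F>. \<forall>\<^sub>\<infinity>n. finite (A `` {n}) \<and> card (A `` {n}) \<le> f n}"

definition family_ideal :: "(nat \<Rightarrow> nat) set \<Rightarrow> (nat \<times> nat) set set" where
  "family_ideal \<F> = {A. \<exists>\<C>. finite \<C> \<and> \<C> \<subseteq> family_generators \<F> \<and> A \<subseteq> \<Union>\<C>}"

definition Borel_family_ideal :: "(nat \<times> nat) set set \<Rightarrow> bool" where
  "Borel_family_ideal \<I> \<longleftrightarrow> Borel_ideal \<I> \<and> (\<exists>\<F>. \<F> \<noteq> {} \<and> \<I> = family_ideal \<F>)"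

section \<open>Inclusion modulo finite sets and the bounding number\<close>

definition almost_subset :: "'a set \<Rightarrow> 'a set \<Rightarrow> bool" (infix "\<subseteq>\<^sup>*" 50) where
  "A \<subseteq>\<^sup>* B \<longleftrightarrow> finite (A - B)"

definition eq_mod_fin :: "('a set \<times> 'a set) set" where
  "eq_mod_fin = {(A, B). A \<subseteq>\<^sup>* B \<and> B \<subseteq>\<^sup>* A}"

definition eventually_le :: "(nat \<Rightarrow> nat) \<Rightarrow> (nat \<Rightarrow> nat) \<Rightarrow> bool" (infix "\<le>\<^sup>*" 50) where
  "f \<le>\<^sup>* g \<longleftrightarrow> (\<forall>\<^sub>\<infinity>n. f n \<le> g n)"

definition unbounded_family :: "(nat \<Rightarrow> nat) set \<Rightarrow> bool" where
  "unbounded_family B \<longleftrightarrow> \<not> (\<exists>g. \<forall>f\<in>B. f \<le>\<^sup>* g)"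

text \<open>Cardinals are wellorders of minimal order type, as in the library, so that the
  initial ordinal \<open>\<bb>\<close> is available as an index set of chains: the ordinals below \<open>\<bb>\<close> are
  represented by the elements of \<open>Field \<bb>\<close>.\<close>

definition bounding_number :: "(nat \<Rightarrow> nat) rel" ("\<bb>") where
  "\<bb> = |SOME B. unbounded_family B \<and> (\<forall>C. unbounded_family C \<longrightarrow> |B| \<le>o |C| )|"

lemma bounding_number:
  shows bounding_number_Card_order: "Card_order \<bb>"
    and bounding_number_attained: "\<exists>B. unbounded_family B \<and> \<bb> =o |B|"
    and bounding_number_least: "unbounded_family C \<Longrightarrow> \<bb> \<le>o |C|"
proof -
  let ?P = "\<lambda>B. unbounded_family B \<and> (\<forall>C. unbounded_family C \<longrightarrow> |B| \<le>o |C| )"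
  have "unbounded_family UNIV"
    unfolding unbounded_family_def
  proof
    assume "\<exists>g. \<forall>f\<in>UNIV. f \<le>\<^sup>* g"
    then obtain g where "(\<lambda>n. Suc (g n)) \<le>\<^sup>* g" by blast
    then show False by (simp add: eventually_le_def)
  qed
  then have "card_of ` Collect unbounded_family \<noteq> {}" by blast
  from exists_minim_Card_order[OF this] have "\<exists>B. ?P B"
    by (auto simp: card_of_Card_order)
  then have *: "?P (SOME B. ?P B)" by (rule someI_ex)
  show "Card_order \<bb>" by (simp add: bounding_number_def card_of_Card_order)
  show "\<exists>B. unbounded_family B \<and> \<bb> =o |B|"
    using * unfolding bounding_number_def by (blast intro: card_of_refl)
  show "unbounded_family C \<Longrightarrow> \<bb> \<le>o |C|"
    using * unfolding bounding_number_def by blast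
qed

end

theory Submission
  imports Defs
begin

text \<open>
  An ideal \<open>J\<close> on \<open>\<omega>\<close> can be spread over the plane: \<open>column_functions J\<close> consists of the functions that are
  bounded off a set in \<open>J\<close>, and the ideal \<open>column_ideal J\<close> that they generate consists of the sets
  whose columns are almost all finite and, off a set in \<open>J\<close>, of bounded size. On such ideals
  the Katetov order and the Katetov--Blass order both agree with the Katetov--Blass order of the
  ideals \<open>J\<close>. One direction shifts columns along a finite-to-one map
  (\<open>column_ideal_katetov_blass_mono\<close>); for the other, an arbitrary reduction of the plane must send
  infinitely many points of almost every column into one column, and this assignment of columns is
  a finite-to-one reduction between the ideals \<open>J\<close> (\<open>column_ideal_katetov_reflect\<close>).

  It remains to embed \<open>\<P>(\<omega>)/Fin\<close> into the Katetov--Blass order of simple ideals on \<open>\<omega>\<close>. Cut \<open>\<omega>\<close> into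
  intervals \<open>[w, w ^ 5)\<close> and let \<open>block_ideal A\<close> consist of the sets \<open>X\<close> whose intersection with
  the \<open>n\<close>-th interval has at most \<open>k * w\<^sup>2\<close> elements if \<open>n \<in> A\<close> and at most \<open>k * w\<close> elements
  otherwise, for some \<open>k\<close> and almost all \<open>n\<close>. The ideal grows with \<open>A\<close>. Conversely, the sizes are so far
  apart that a finite-to-one reduction cannot essentially move a block: maps to earlier blocks have
  too large fibres, and what goes to later blocks is negligible there. So a reduction of
  \<open>block_ideal A\<close> to \<open>block_ideal B\<close> compares growth rates block by block, which forces
  \<open>A \<subseteq>\<^sup>* B\<close> (\<open>block_ideal_reflect\<close>).

  Membership in \<open>column_ideal (block_ideal A)\<close> is a countable union of countable intersections
  of countable unions of closed conditions, where the inner union expresses that a column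
  is finite; this gives the class \<open>\<Sigma>\<^sup>0\<^sub>4\<close>. The antichain is the image of an almost disjoint
  family, and the chains are the images of the undergraphs of a strictly \<open>\<le>\<^sup>*\<close>-increasing sequence of
  length \<open>\<bb>\<close>, and of their complements.
\<close>

section \<open>Spreading an ideal on the columns over the plane\<close>

text \<open>The columns that violate the bound \<open>c\<close>. Infinite columns violate every bound; they have to be
  named because \<open>card\<close> maps them to \<open>0\<close>.\<close>

definition big_columns :: "nat \<Rightarrow> (nat \<times> nat) set \<Rightarrow> nat set" where
  "big_columns c S = {n. infinite (S `` {n}) \<or> c < card (S `` {n})}"

definition column_functions :: "nat set set \<Rightarrow> (nat \<Rightarrow> nat) set" where
  "column_functions J = {f. \<exists>c. {n. c < f n} \<in> J}"

text \<open>An explicit form of the ideal generated by \<open>column_functions J\<close>: a uniform bound on the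
  cardinality of the columns is imposed off a set in \<open>J\<close>, while on that set the columns
  only have to be finite, with finitely many exceptions.\<close>

definition column_ideal :: "nat set set \<Rightarrow> (nat \<times> nat) set set" where
  "column_ideal J = {S. (\<forall>\<^sub>\<infinity>n. finite (S `` {n})) \<and> (\<exists>c. big_columns c S \<in> J)}"

lemma idealD:
  assumes "is_ideal J"
  shows ideal_subset: "A \<in> J \<Longrightarrow> B \<subseteq> A \<Longrightarrow> B \<in> J"
    and ideal_Un: "A \<in> J \<Longrightarrow> B \<in> J \<Longrightarrow> A \<union> B \<in> J"
    and ideal_finite: "finite A \<Longrightarrow> A \<in> J"
  using assms unfolding is_ideal_def by blast+

lemma big_columns_mono: "S \<subseteq> T \<Longrightarrow> big_columns c S \<subseteq> big_columns c T"
  unfolding big_columns_def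
  by (smt (verit, best) Collect_mono Image_mono card_mono infinite_super order_less_le_trans subset_refl)

lemma big_columns_Un: "big_columns (c + d) (S \<union> T) \<subseteq> big_columns c S \<union> big_columns d T"
proof
  fix n assume n: "n \<in> big_columns (c + d) (S \<union> T)"
  have "card ((S \<union> T) `` {n}) \<le> card (S `` {n}) + card (T `` {n})"
    by (simp add: Un_Image card_Un_le)
  then show "n \<in> big_columns c S \<union> big_columns d T"
    using n by (auto simp: big_columns_def Un_Image)
qed

lemma column_ideal_subset:
  assumes "is_ideal J" "S \<in> column_ideal J" "T \<subseteq> S"
  shows "T \<in> column_ideal J"
proof -
  obtain c where c: "\<forall>\<^sub>\<infinity>n. finite (S `` {n})" "big_columns c S \<in> J"
    using assms(2) by (auto simp: column_ideal_def)
  have "\<forall>\<^sub>\<infinity>n. finite (T `` {n})"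
    using c(1) by (rule MOST_mono) (meson Image_mono assms(3) finite_subset subset_refl)
  moreover have "big_columns c T \<in> J"
    using ideal_subset[OF assms(1) c(2)] big_columns_mono[OF assms(3)] by blast
  ultimately show ?thesis by (auto simp: column_ideal_def)
qed

lemma column_ideal_Un:
  assumes "is_ideal J" "S \<in> column_ideal J" "T \<in> column_ideal J"
  shows "S \<union> T \<in> column_ideal J"
proof -
  obtain c d where c: "\<forall>\<^sub>\<infinity>n. finite (S `` {n})" "big_columns c S \<in> J"
    and d: "\<forall>\<^sub>\<infinity>n. finite (T `` {n})" "big_columns d T \<in> J"
    using assms(2,3) by (auto simp: column_ideal_def)
  have "\<forall>\<^sub>\<infinity>n. finite ((S \<union> T) `` {n})"
    using c(1) d(1) by (simp add: Un_Image MOST_conj_distrib)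
  moreover have "big_columns (c + d) (S \<union> T) \<in> J"
    using ideal_subset[OF assms(1) ideal_Un[OF assms(1) c(2) d(2)] big_columns_Un] .
  ultimately show ?thesis by (auto simp: column_ideal_def)
qed

text \<open>A whole column and, below, the graph of a partial function are the two kinds of small sets that
  are tested against a Katetov reduction.\<close>

lemma column_ideal_columnI: "is_ideal J \<Longrightarrow> {n} \<times> UNIV \<in> column_ideal J"
proof -
  assume J: "is_ideal J"
  have "big_columns 0 ({n} \<times> UNIV) \<subseteq> {n}" by (auto simp: big_columns_def Image_def)
  then have "big_columns 0 ({n} \<times> UNIV) \<in> J"
    by (intro ideal_finite[OF J]) (auto intro: finite_subset)
  moreover have "\<forall>\<^sub>\<infinity>m. finite (({n} \<times> UNIV) `` {m} :: nat set)"
    unfolding eventually_cofinite by (rule finite_subset[of _ "{n}"]) (auto simp: Image_def)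
  ultimately show ?thesis by (auto simp: column_ideal_def)
qed

lemma column_ideal_graphI:
  assumes "is_ideal J" "inj_on fst S"
  shows "S \<in> column_ideal J"
proof -
  have "finite (S `` {n}) \<and> card (S `` {n}) \<le> 1" for n
  proof (cases "S `` {n} = {}")
    case False
    then obtain i where "(n, i) \<in> S" by auto
    then have "S `` {n} = {i}" using assms(2) by (force simp: inj_on_def)
    then show ?thesis by simp
  qed simp
  then have "big_columns 1 S = {}" "\<forall>n. finite (S `` {n})"
    by (auto simp: big_columns_def not_less[symmetric])
  moreover have "{} \<in> J" using ideal_finite[OF assms(1)] by simp
  ultimately have "big_columns 1 S \<in> J" "\<forall>\<^sub>\<infinity>n. finite (S `` {n})" by simp_all
  then show ?thesis unfolding column_ideal_def by blast
qed

lemma column_ideal_ideal: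
  assumes J: "is_ideal J"
  shows "is_ideal (column_ideal J)"
  unfolding is_ideal_def
proof (intro conjI ballI allI impI)
  fix S :: "(nat \<times> nat) set" assume S: "finite S"
  have "finite (S `` {n})" for n using S by simp
  moreover have "big_columns 0 S \<subseteq> fst ` S"
    by (auto simp: big_columns_def card_gt_0_iff S image_iff)
      (metis Image_singleton_iff S finite_Image fst_conv)
  ultimately have "big_columns 0 S \<in> J" "\<forall>\<^sub>\<infinity>n. finite (S `` {n})"
    using ideal_finite[OF J] S finite_subset[of "big_columns 0 S" "fst ` S"] by simp_all
  then show "S \<in> column_ideal J" unfolding column_ideal_def by blast
next
  show "UNIV \<notin> column_ideal J" by (auto simp: column_ideal_def Image_def)
qed (use J in \<open>auto intro: column_ideal_subset column_ideal_Un\<close>)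

text \<open>The set on the right is an ideal, so only generators matter for one inclusion. For the other, a
  member \<open>S\<close> is itself a generator, witnessed by the function \<open>n \<mapsto> card (S `` {n})\<close>.\<close>

lemma family_ideal_column_functions:
  assumes J: "is_ideal J"
  shows "family_ideal (column_functions J) = column_ideal J"
proof (intro equalityI subsetI)
  have gen: "G \<in> column_ideal J" if G: "G \<in> family_generators (column_functions J)" for G
  proof -
    obtain f c where f: "{n. c < f n} \<in> J" "\<forall>\<^sub>\<infinity>n. finite (G `` {n}) \<and> card (G `` {n}) \<le> f n"
      using G by (auto simp: family_generators_def column_functions_def)
    let ?E = "{n. \<not> (finite (G `` {n}) \<and> card (G `` {n}) \<le> f n)}"
    have "big_columns c G \<subseteq> {n. c < f n} \<union> ?E" by (auto simp: big_columns_def)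
    moreover have "finite ?E" using f(2) by (simp add: eventually_cofinite)
    ultimately have "big_columns c G \<in> J"
      using ideal_subset[OF J ideal_Un[OF J f(1) ideal_finite[OF J]]] by blast
    moreover have "\<forall>\<^sub>\<infinity>n. finite (G `` {n})" using f(2) by (rule MOST_mono) simp
    ultimately show ?thesis by (auto simp: column_ideal_def)
  qed
  fix S assume "S \<in> family_ideal (column_functions J)"
  then obtain C where C: "finite C" "C \<subseteq> family_generators (column_functions J)" "S \<subseteq> \<Union>C"
    by (auto simp: family_ideal_def)
  have "\<Union>C \<in> column_ideal J"
    using C(1,2)
  proof (induction rule: finite_induct)
    case empty
    then show ?case using ideal_finite[OF column_ideal_ideal[OF J]] by simp
  next
    case (insert G C)
    then show ?case using gen column_ideal_Un[OF J] by simp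
  qed
  then show "S \<in> column_ideal J" using C(3) column_ideal_subset[OF J] by blast
next
  fix S assume "S \<in> column_ideal J"
  then obtain c where c: "\<forall>\<^sub>\<infinity>n. finite (S `` {n})" "big_columns c S \<in> J"
    by (auto simp: column_ideal_def)
  have "{n. c < card (S `` {n})} \<in> J"
    by (rule ideal_subset[OF J c(2)]) (auto simp: big_columns_def)
  then have "S \<in> family_generators (column_functions J)"
    using c(1) by (auto simp: family_generators_def column_functions_def)
  then have "finite {S} \<and> {S} \<subseteq> family_generators (column_functions J) \<and> S \<subseteq> \<Union>{S}" by simp
  then show "S \<in> family_ideal (column_functions J)" unfolding family_ideal_def by blast
qed

lemma ED_le_column_ideal:
  assumes J: "is_ideal J"
  shows "ED \<le>\<^sub>K column_ideal J"
proof -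
  have "S \<in> column_ideal J" if S: "S \<in> ED" for S
  proof -
    obtain m where m: "\<forall>\<^sub>\<infinity>n. finite (S `` {n}) \<and> card (S `` {n}) < m"
      using S by (auto simp: ED_def)
    have "finite (big_columns m S)"
      using m unfolding eventually_cofinite
      by (rule rev_finite_subset) (auto simp: big_columns_def)
    moreover have "\<forall>\<^sub>\<infinity>n. finite (S `` {n})" using m by (rule MOST_mono) simp
    ultimately show ?thesis using ideal_finite[OF J] by (auto simp: column_ideal_def)
  qed
  then show ?thesis unfolding katetov_le_def by (intro exI[of _ id]) simp
qed

lemma column_ideal_le_FinFin: "column_ideal J \<le>\<^sub>K FinFin"
  unfolding katetov_le_def by (intro exI[of _ id]) (auto simp: column_ideal_def FinFin_def)

text \<open>A finite-to-one map between columns acts on the plane by shifting whole columns, keeping the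
  second coordinate. Finite fibres are needed so that the finitely many infinite columns of a member
  pull back to finitely many columns.\<close>

lemma column_ideal_katetov_blass_mono:
  assumes "J \<le>\<^sub>K\<^sub>B J'"
  shows "column_ideal J \<le>\<^sub>K\<^sub>B column_ideal J'"
proof -
  obtain \<phi> where fin: "\<And>n. finite (\<phi> -` {n})" and pre: "\<And>X. X \<in> J \<Longrightarrow> \<phi> -` X \<in> J'"
    using assms by (auto simp: katetov_blass_le_def)
  define h where "h = map_prod \<phi> (id :: nat \<Rightarrow> nat)"
  have sec: "(h -` S) `` {m} = S `` {\<phi> m}" for S m
    by (auto simp: h_def)
  have "finite (h -` {x})" for x
  proof (rule finite_subset)
    show "h -` {x} \<subseteq> \<phi> -` {fst x} \<times> {snd x}" by (auto simp: h_def)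
  qed (simp add: fin)
  moreover have "h -` S \<in> column_ideal J'" if S: "S \<in> column_ideal J" for S
  proof -
    obtain c where c: "\<forall>\<^sub>\<infinity>n. finite (S `` {n})" "big_columns c S \<in> J"
      using S by (auto simp: column_ideal_def)
    have "{m. infinite ((h -` S) `` {m})} = (\<Union>n\<in>{n. infinite (S `` {n})}. \<phi> -` {n})"
      by (auto simp: sec)
    then have "\<forall>\<^sub>\<infinity>m. finite ((h -` S) `` {m})"
      using c(1) fin by (simp add: eventually_cofinite)
    moreover have "big_columns c (h -` S) = \<phi> -` big_columns c S"
      by (auto simp: big_columns_def sec)
    ultimately have "big_columns c (h -` S) \<in> J'" "\<forall>\<^sub>\<infinity>m. finite ((h -` S) `` {m})"
      using pre[OF c(2)] by simp_all
    then show ?thesis unfolding column_ideal_def by blast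
  qed
  ultimately show ?thesis unfolding katetov_blass_le_def by blast
qed

lemma katetov_blass_imp_katetov: "\<I> \<le>\<^sub>K\<^sub>B \<J> \<Longrightarrow> \<I> \<le>\<^sub>K \<J>"
  by (auto simp: katetov_le_def katetov_blass_le_def)

text \<open>A reduction \<open>h\<close> between the ideals on the plane carries a finite-to-one reduction between
  the ideals of columns inside it. For almost every \<open>m\<close>, the column \<open>m\<close> is mapped into finitely
  many columns: otherwise infinitely many columns spread over infinitely many columns, and a single
  graph could be chosen that meets the image of each of them infinitely often; its preimage then has
  infinitely many infinite columns. Hence almost every column \<open>m\<close> has infinitely many points sent to
  one column \<open>\<phi> m\<close>. The map \<open>\<phi>\<close> is finite-to-one, because the preimage of a column has only finitely
  many infinite columns. Finally, given \<open>X \<in> J\<close>, one puts into each column over \<open>X\<close> finitely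
  many points, enough for the preimage to have at least \<open>m\<close> points in each column \<open>m \<in> \<phi> -` X\<close>
  outside a finite set. Such a set is in \<open>column_ideal J\<close>, so the unbounded columns of its
  preimage form a set in \<open>J'\<close>.\<close>

lemma column_ideal_katetov_reflect:
  assumes J: "is_ideal J" and J': "is_ideal J'"
    and le: "column_ideal J \<le>\<^sub>K column_ideal J'"
  shows "J \<le>\<^sub>K\<^sub>B J'"
proof -
  obtain h where h: "\<And>S. S \<in> column_ideal J \<Longrightarrow> h -` S \<in> column_ideal J'"
    using le by (auto simp: katetov_le_def)
  have fin: "finite {m. infinite ((h -` S) `` {m})}" if "S \<in> column_ideal J" for S
    using h[OF that] by (auto simp: column_ideal_def eventually_cofinite)
  define M where "M = {m. infinite (range (\<lambda>i. fst (h (m, i))))}"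
  have "finite M"
  proof (rule ccontr)
    assume M: "infinite M"
    \<comment> \<open>\<open>e\<close> runs through \<open>M\<close> taking each value infinitely often. Choosing \<open>q k\<close> so that the first
      coordinates of the points \<open>h (e k, q k)\<close> increase strictly makes these points a graph.\<close>
    define e where "e k = enumerate M (fst (prod_decode k))" for k
    have eM: "e k \<in> M" for k using M by (simp add: e_def enumerate_in_set)
    have e_inf: "infinite {k. e k = m}" if m: "m \<in> M" for m
    proof -
      obtain a where a: "enumerate M a = m" using enumerate_Ex[OF M m] ..
      have "range (\<lambda>b. prod_encode (a, b)) \<subseteq> {k. e k = m}" by (auto simp: e_def a)
      moreover have "infinite (range (\<lambda>b. prod_encode (a, b)))"
        by (rule range_inj_infinite) (auto simp: inj_on_def prod_encode_eq)
      ultimately show ?thesis using infinite_super by blast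
    qed
    have step: "\<exists>i. N < fst (h (e k, i))" for k N
    proof -
      have "infinite (range (\<lambda>i. fst (h (e k, i))))" using eM[of k] by (simp add: M_def)
      then show ?thesis by (auto dest: infinite_nat_iff_unbounded[THEN iffD1, rule_format])
    qed
    have "\<exists>q. \<forall>k. True \<and> fst (h (e k, q k)) < fst (h (e (Suc k), q (Suc k)))"
      by (rule dependent_nat_choice) (use step in auto)
    then obtain q where q: "\<And>k. fst (h (e k, q k)) < fst (h (e (Suc k), q (Suc k)))"
      by blast
    then have mono: "strict_mono (\<lambda>k. fst (h (e k, q k)))" by (simp add: strict_mono_Suc_iff)
    define S where "S = range (\<lambda>k. h (e k, q k))"
    have "inj_on fst S"
      using strict_mono_eq[OF mono] by (auto simp: S_def inj_on_def)
    then have "finite {m. infinite ((h -` S) `` {m})}"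
      by (intro fin column_ideal_graphI J)
    moreover have "M \<subseteq> {m. infinite ((h -` S) `` {m})}"
    proof clarify
      fix m assume m: "m \<in> M" and f: "finite ((h -` S) `` {m})"
      have "q ` {k. e k = m} \<subseteq> (h -` S) `` {m}" by (auto simp: S_def)
      moreover have "inj_on q {k. e k = m}"
        by (rule inj_onI) (metis (mono_tags, lifting) mem_Collect_eq strict_mono_eq[OF mono])
      ultimately show False using e_inf[OF m] f finite_imageD finite_subset by blast
    qed
    ultimately show False using M finite_subset by blast
  qed
  have ex: "\<exists>n. infinite {i. fst (h (m, i)) = n}" if "m \<notin> M" for m
    using pigeonhole_infinite[of "UNIV :: nat set" "\<lambda>i. fst (h (m, i))"] that
    by (auto simp: M_def)
  define \<phi> where "\<phi> m = (if m \<in> M then m else SOME n. infinite {i. fst (h (m, i)) = n})" for m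
  have \<phi>: "infinite {i. fst (h (m, i)) = \<phi> m}" if "m \<notin> M" for m
    using someI_ex[OF ex[OF that]] that by (simp add: \<phi>_def)
  have \<phi>_fin: "finite (\<phi> -` {n})" for n
  proof (rule finite_subset)
    have "infinite ((h -` ({n} \<times> UNIV)) `` {m})" if "m \<notin> M" "\<phi> m = n" for m
    proof -
      have "(h -` ({n} \<times> UNIV)) `` {m} = {i. fst (h (m, i)) = n}" by (auto simp: mem_Times_iff)
      then show ?thesis using \<phi> that by auto
    qed
    then show "\<phi> -` {n} \<subseteq> M \<union> {m. infinite ((h -` ({n} \<times> UNIV)) `` {m})}" by blast
    show "finite (M \<union> {m. infinite ((h -` ({n} \<times> UNIV)) `` {m})})"
      using \<open>finite M\<close> fin[OF column_ideal_columnI[OF J]] by blast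
  qed
  \<comment> \<open>The size \<open>m\<close> of \<open>Z m\<close> is any choice that exceeds each constant \<open>c\<close> for almost all \<open>m\<close>.\<close>
  have "\<forall>m. \<exists>Z. m \<notin> M \<longrightarrow> finite Z \<and> card Z = m \<and> Z \<subseteq> {i. fst (h (m, i)) = \<phi> m}"
    using \<phi> infinite_arbitrarily_large by blast
  then obtain Z where Z: "\<And>m. m \<notin> M \<Longrightarrow> finite (Z m)" "\<And>m. m \<notin> M \<Longrightarrow> card (Z m) = m"
    "\<And>m. m \<notin> M \<Longrightarrow> Z m \<subseteq> {i. fst (h (m, i)) = \<phi> m}"
    by metis
  have "\<phi> -` X \<in> J'" if X: "X \<in> J" for X
  proof -
    define S where "S = {h (m, i) | m i. m \<notin> M \<and> \<phi> m \<in> X \<and> i \<in> Z m}"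
    have S_fin: "finite (S `` {n})" for n
    proof (rule finite_subset)
      show "S `` {n} \<subseteq> (\<Union>m \<in> \<phi> -` {n} - M. (\<lambda>i. snd (h (m, i))) ` Z m)"
      proof
        fix x assume "x \<in> S `` {n}"
        then obtain m i where m: "h (m, i) = (n, x)" "m \<notin> M" "i \<in> Z m"
          unfolding S_def by force
        then have "\<phi> m = n" using Z(3)[of m] by auto
        moreover have "x = snd (h (m, i))" using m(1) by simp
        ultimately show "x \<in> (\<Union>m \<in> \<phi> -` {n} - M. (\<lambda>i. snd (h (m, i))) ` Z m)"
          using m(2,3) by blast
      qed
    qed (use \<phi>_fin Z(1) in auto)
    have S_X: "n \<in> X" if x: "(n, x) \<in> S" for n x
    proof -
      obtain m i where m: "h (m, i) = (n, x)" "m \<notin> M" "i \<in> Z m" "\<phi> m \<in> X"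
        using x unfolding S_def by force
      then show ?thesis using Z(3)[of m] by auto
    qed
    have "big_columns 0 S \<subseteq> X"
    proof
      fix n assume "n \<in> big_columns 0 S"
      then have "S `` {n} \<noteq> {}" by (auto simp: big_columns_def)
      then show "n \<in> X" using S_X by blast
    qed
    then have "big_columns 0 S \<in> J" using ideal_subset[OF J X] by blast
    then have "S \<in> column_ideal J" using S_fin by (auto simp: column_ideal_def)
    then obtain c where c: "big_columns c (h -` S) \<in> J'"
      using h by (auto simp: column_ideal_def)
    have "\<phi> -` X \<subseteq> big_columns c (h -` S) \<union> (M \<union> {..c})"
    proof
      fix m assume m: "m \<in> \<phi> -` X"
      show "m \<in> big_columns c (h -` S) \<union> (M \<union> {..c})"
      proof (cases "m \<in> M \<or> m \<le> c")
        case False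
        then have "Z m \<subseteq> (h -` S) `` {m}" using m by (auto simp: S_def)
        then have "infinite ((h -` S) `` {m}) \<or> m \<le> card ((h -` S) `` {m})"
          using Z(2)[of m] False card_mono by metis
        then show ?thesis using False by (auto simp: big_columns_def)
      qed auto
    qed
    moreover have "big_columns c (h -` S) \<union> (M \<union> {..c}) \<in> J'"
      by (intro ideal_Un[OF J'] c ideal_finite[OF J']) (use \<open>finite M\<close> in auto)
    ultimately show ?thesis using ideal_subset[OF J'] by blast
  qed
  then show ?thesis using \<phi>_fin unfolding katetov_blass_le_def by blast
qed

section \<open>Ideals with two growth rates on rapidly growing blocks\<close>

text \<open>Consecutive bounds are fifth powers of each other. This leaves room, inside a block that starts
  at \<open>w\<close>, for the two growth rates \<open>w\<close> and \<open>w\<^sup>2\<close>, with the size \<open>w ^ 5 - w\<close> of the block far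
  above both, and the next \<open>w\<close> above the sum of all earlier squares.\<close>

definition block_bound :: "nat \<Rightarrow> nat" where
  "block_bound n = 2 ^ (5 ^ n)"

definition block :: "nat \<Rightarrow> nat set" where
  "block n = {block_bound n..<block_bound (Suc n)}"

definition growth :: "nat set \<Rightarrow> nat \<Rightarrow> nat" where
  "growth A n = (if n \<in> A then (block_bound n)\<^sup>2 else block_bound n)"

definition block_ideal :: "nat set \<Rightarrow> nat set set" where
  "block_ideal A = {X. \<exists>k. \<forall>\<^sub>\<infinity>n. card (X \<inter> block n) \<le> k * growth A n}"

lemma block_bound_Suc: "block_bound (Suc n) = block_bound n ^ 5"
  by (simp add: block_bound_def power_mult[symmetric] mult.commute)

lemma block_bound_ge_2: "2 \<le> block_bound n"
  by (simp add: block_bound_def self_le_power)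

lemma less_block_bound: "n < block_bound n"
proof -
  have "n < (5::nat) ^ n" by (rule less_exp[THEN less_le_trans]) (simp add: power_mono)
  also have "\<dots> < 2 ^ 5 ^ n" by (rule less_exp)
  finally show ?thesis by (simp add: block_bound_def)
qed

lemma block_bound_mono: "m \<le> n \<Longrightarrow> block_bound m \<le> block_bound n"
  by (simp add: block_bound_def power_increasing)

lemma block_bound_le_square: "block_bound n \<le> (block_bound n)\<^sup>2"
  using block_bound_ge_2[of n] by (simp add: power2_eq_square)

lemma block_bound_le_growth: "block_bound n \<le> growth A n"
  by (simp add: growth_def block_bound_le_square)

lemma growth_le_square: "growth A n \<le> (block_bound n)\<^sup>2"
  by (simp add: growth_def block_bound_le_square)

lemma finite_block [simp]: "finite (block n)"
  by (simp add: block_def)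

text \<open>The form in which the size of a block is used: a map on the block with fewer than \<open>w\<^sup>2\<close> points
  in each fibre has at least \<open>w\<^sup>2\<close> values besides those below \<open>w\<close>.\<close>

lemma card_block_ge:
  "((block_bound n)\<^sup>2 + block_bound n) * (block_bound n)\<^sup>2 \<le> card (block n)"
proof -
  define w where "w = block_bound n"
  have w: "2 \<le> w" using block_bound_ge_2 by (simp add: w_def)
  have "(w\<^sup>2 + w) * w\<^sup>2 + w \<le> w ^ 5"
  proof -
    have "(w\<^sup>2 + w) * w\<^sup>2 + w = w ^ 4 + w ^ 3 + w"
      by (simp add: algebra_simps eval_nat_numeral)
    also have "\<dots> \<le> w ^ 4 + 2 * w ^ 3" using w self_le_power[of w 3] by simp
    also have "\<dots> \<le> w ^ 4 + w * w ^ 3" using mult_right_mono[OF w, of "w ^ 3"] by simp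
    also have "\<dots> = 2 * w ^ 4" by (simp add: eval_nat_numeral)
    also have "\<dots> \<le> w * w ^ 4" using mult_right_mono[OF w, of "w ^ 4"] by simp
    finally show ?thesis by (simp add: eval_nat_numeral)
  qed
  then show ?thesis by (simp add: block_def block_bound_Suc w_def)
qed

text \<open>Parts of size \<open>(block_bound n)\<^sup>2\<close> coming from all earlier blocks \<open>n\<close> fit together within the
  smaller growth rate of a later block.\<close>

lemma sum_square_block_bound_le: "(\<Sum>n<m. (block_bound n)\<^sup>2) \<le> block_bound m"
proof (induction m)
  case (Suc m)
  define w where "w = block_bound m"
  have w: "2 \<le> w" using block_bound_ge_2 by (simp add: w_def)
  have "w + w\<^sup>2 \<le> w ^ 5"
  proof -
    have "w + w\<^sup>2 \<le> 2 * w\<^sup>2" using w self_le_power[of w 2] by simp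
    also have "\<dots> \<le> w * w\<^sup>2" using mult_right_mono[OF w, of "w\<^sup>2"] by simp
    also have "\<dots> = w ^ 3" by (simp add: eval_nat_numeral)
    also have "\<dots> \<le> w ^ 5" using w by (intro power_increasing) auto
    finally show ?thesis .
  qed
  then show ?case using Suc by (simp add: block_bound_Suc w_def)
qed simp

lemma eventually_mult_block_bound_less: "\<forall>\<^sub>\<infinity>n. k * block_bound n < (block_bound n)\<^sup>2"
  unfolding MOST_nat
proof (intro exI allI impI)
  fix n assume "k < n"
  then have "k < block_bound n" using less_block_bound[of n] by simp
  then show "k * block_bound n < (block_bound n)\<^sup>2"
    using block_bound_ge_2[of n] by (simp add: power2_eq_square)
qed

lemma block_ideal_ideal: "is_ideal (block_ideal A)"
  unfolding is_ideal_def
proof (intro conjI ballI allI impI)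
  fix X Y assume "X \<in> block_ideal A" and Y: "Y \<subseteq> X"
  then obtain k where k: "\<forall>\<^sub>\<infinity>n. card (X \<inter> block n) \<le> k * growth A n"
    by (auto simp: block_ideal_def)
  have "card (Y \<inter> block n) \<le> card (X \<inter> block n)" for n
    using Y by (intro card_mono) auto
  then have "\<forall>\<^sub>\<infinity>n. card (Y \<inter> block n) \<le> k * growth A n"
    using k by (auto elim!: MOST_mono intro: order_trans)
  then show "Y \<in> block_ideal A" by (auto simp: block_ideal_def)
next
  fix X Y assume "X \<in> block_ideal A" "Y \<in> block_ideal A"
  then obtain k l where k: "\<forall>\<^sub>\<infinity>n. card (X \<inter> block n) \<le> k * growth A n"
    and l: "\<forall>\<^sub>\<infinity>n. card (Y \<inter> block n) \<le> l * growth A n"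
    by (auto simp: block_ideal_def)
  have "\<forall>\<^sub>\<infinity>n. card ((X \<union> Y) \<inter> block n) \<le> (k + l) * growth A n"
    using MOST_conjI[OF k l]
  proof (rule MOST_mono)
    fix n assume "card (X \<inter> block n) \<le> k * growth A n \<and> card (Y \<inter> block n) \<le> l * growth A n"
    then show "card ((X \<union> Y) \<inter> block n) \<le> (k + l) * growth A n"
      using card_Un_le[of "X \<inter> block n" "Y \<inter> block n"]
      by (simp add: Int_Un_distrib2 add_mult_distrib)
  qed
  then show "X \<union> Y \<in> block_ideal A" unfolding block_ideal_def by blast
next
  fix X :: "nat set" assume "finite X"
  then obtain N where N: "X \<subseteq> {..<N}" by (meson finite_nat_iff_bounded)
  have "X \<inter> block n = {}" if "N < n" for n
    using N that less_block_bound[of n] by (fastforce simp: block_def)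
  then have "\<forall>\<^sub>\<infinity>n. card (X \<inter> block n) \<le> 0 * growth A n" unfolding MOST_nat by fastforce
  then show "X \<in> block_ideal A" unfolding block_ideal_def by blast
next
  show "UNIV \<notin> block_ideal A"
  proof
    assume "UNIV \<in> block_ideal A"
    then obtain k where "\<forall>\<^sub>\<infinity>n. card (block n) \<le> k * growth A n"
      by (auto simp: block_ideal_def)
    from MOST_conjI[OF this eventually_mult_block_bound_less[of k]]
    obtain n where n: "card (block n) \<le> k * growth A n" "k * block_bound n < (block_bound n)\<^sup>2"
      using MOST_nat by (metis (no_types, lifting) lessI)
    define w where "w = block_bound n"
    have w: "2 \<le> w" using block_bound_ge_2 by (simp add: w_def)
    have "(w\<^sup>2 + w) * w\<^sup>2 \<le> card (block n)"
      using card_block_ge by (simp add: w_def)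
    also have "\<dots> \<le> k * w\<^sup>2"
      using n(1) growth_le_square[of A n] unfolding w_def by (meson le_trans mult_le_mono2)
    finally have "(w\<^sup>2 + w) * w\<^sup>2 \<le> k * w\<^sup>2" .
    moreover have "k < w" using n(2) by (simp add: w_def power2_eq_square)
    ultimately show False using w by simp
  qed
qed

text \<open>Enlarging \<open>A\<close> only raises the growth rates, and a finite set of blocks does not matter.\<close>

lemma block_ideal_mono:
  assumes "A \<subseteq>\<^sup>* B"
  shows "block_ideal A \<subseteq> block_ideal B"
proof
  fix X assume "X \<in> block_ideal A"
  then obtain k where k: "\<forall>\<^sub>\<infinity>n. card (X \<inter> block n) \<le> k * growth A n"
    by (auto simp: block_ideal_def)
  have "\<forall>\<^sub>\<infinity>n. n \<notin> A - B"
    using assms by (simp add: almost_subset_def eventually_cofinite set_diff_eq)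
  from MOST_conjI[OF k this] have "\<forall>\<^sub>\<infinity>n. card (X \<inter> block n) \<le> k * growth B n"
  proof (rule MOST_mono)
    fix n assume n: "card (X \<inter> block n) \<le> k * growth A n \<and> n \<notin> A - B"
    then have "growth A n \<le> growth B n" by (auto simp: growth_def block_bound_le_square)
    then show "card (X \<inter> block n) \<le> k * growth B n"
      using n by (meson le_trans mult_le_mono2)
  qed
  then show "X \<in> block_ideal B" by (auto simp: block_ideal_def)
qed

lemma block_ideal_katetov_blass_mono:
  assumes "A \<subseteq>\<^sup>* B"
  shows "block_ideal A \<le>\<^sub>K\<^sub>B block_ideal B"
  unfolding katetov_blass_le_def
  using block_ideal_mono[OF assms] by (intro exI[of _ id]) auto

text \<open>Each block is finite, so an infinite set meets infinitely many of them, and one point from each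
  satisfies every growth condition.\<close>

lemma block_ideal_tall:
  assumes "infinite P"
  obtains P' where "P' \<subseteq> P" "infinite P'" "P' \<in> block_ideal A"
proof -
  define b where "b x = (LEAST n. x < block_bound (Suc n))" for x
  have less_b: "x < block_bound (Suc (b x))" for x
    unfolding b_def
    by (rule LeastI[of _ x]) (meson Suc_lessD less_block_bound)
  have b_block: "b x = n" if x: "x \<in> block n" for x n
    unfolding b_def
  proof (rule Least_equality)
    show "x < block_bound (Suc n)" using x by (simp add: block_def)
    show "n \<le> m" if "x < block_bound (Suc m)" for m
      using that x block_bound_mono[of "Suc m" n] by (force simp: block_def not_le[symmetric])
  qed
  have "infinite (b ` P)"
  proof
    assume "finite (b ` P)"
    then obtain x0 where x0: "infinite {x \<in> P. b x = b x0}"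
      using pigeonhole_infinite[OF assms] by blast
    have "{x \<in> P. b x = b x0} \<subseteq> {..<block_bound (Suc (b x0))}"
      using less_b by (metis (mono_tags, lifting) lessThan_iff mem_Collect_eq subsetI)
    then show False using x0 finite_subset by blast
  qed
  moreover obtain P' where P': "P' \<subseteq> P" "inj_on b P'" "b ` P = b ` P'"
    using subset_image_inj[of "b ` P" b P] by blast
  ultimately have "infinite P'" by (metis finite_imageI)
  have "card (P' \<inter> block n) \<le> 1" for n
  proof -
    have "b ` (P' \<inter> block n) \<subseteq> {n}" using b_block by auto
    moreover have "inj_on b (P' \<inter> block n)" using P'(2) by (meson inf_le1 inj_on_subset)
    ultimately show ?thesis
      by (metis card_image card.empty card_insert_disjoint card_mono empty_iff finite.intros One_nat_def)
  qed
  moreover have "1 \<le> growth A n" for n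
    using block_bound_ge_2[of n] block_bound_le_growth[of n A] by simp
  ultimately have "\<forall>\<^sub>\<infinity>n. card (P' \<inter> block n) \<le> 1 * growth A n"
    by (metis (no_types, lifting) ALL_MOST le_trans mult_1)
  then have "P' \<in> block_ideal A" unfolding block_ideal_def by blast
  then show ?thesis using that P'(1) \<open>infinite P'\<close> by blast
qed

text \<open>Let \<open>\<phi>\<close> be a finite-to-one reduction and suppose that \<open>A - B\<close> is infinite. On a block \<open>n\<close>
  with \<open>n \<in> A - B\<close> and lower bound \<open>w\<close>, the smaller rate \<open>w\<close> governs the preimages, so no member of
  \<open>block_ideal A\<close> may have at least \<open>w\<^sup>2\<close> preimages in infinitely many such blocks. If \<open>\<phi>\<close> has a
  fibre with \<open>w\<^sup>2\<close> points in infinitely many of these blocks, then tallness combines infinitely many such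
  fibres into one member. Otherwise \<open>\<phi>\<close> takes on almost all of these blocks at least \<open>w\<^sup>2\<close>
  values that are not below \<open>w\<close>; selecting \<open>w\<^sup>2\<close> such values for each of these blocks gives a
  member of \<open>block_ideal A\<close>: values in the block itself are allowed as \<open>n \<in> A\<close>, and the growth of
  the blocks absorbs those in later blocks.\<close>

lemma block_ideal_reflect:
  assumes le: "block_ideal A \<le>\<^sub>K\<^sub>B block_ideal B"
  shows "A \<subseteq>\<^sup>* B"
proof (rule ccontr)
  define w where "w = block_bound"
  define M where "M = A - B"
  assume "\<not> A \<subseteq>\<^sup>* B"
  then have M: "infinite M" by (simp add: almost_subset_def M_def)
  obtain \<phi> where fin: "\<And>x. finite (\<phi> -` {x})"
    and pre: "\<And>X. X \<in> block_ideal A \<Longrightarrow> \<phi> -` X \<in> block_ideal B"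
    using le by (auto simp: katetov_blass_le_def)
  have key: "finite {n \<in> M. (w n)\<^sup>2 \<le> card (\<phi> -` X \<inter> block n)}" if X: "X \<in> block_ideal A" for X
  proof -
    obtain k where "\<forall>\<^sub>\<infinity>n. card (\<phi> -` X \<inter> block n) \<le> k * growth B n"
      using pre[OF X] by (auto simp: block_ideal_def)
    from MOST_conjI[OF this eventually_mult_block_bound_less[of k]] show ?thesis
      unfolding eventually_cofinite
      by (rule rev_finite_subset) (auto simp: M_def growth_def w_def)
  qed
  \<comment> \<open>The blocks on which some single point has a large fibre.\<close>
  define M1 where "M1 = {n \<in> M. \<exists>p. (w n)\<^sup>2 \<le> card (\<phi> -` {p} \<inter> block n)}"
  have "finite M1"
  proof (rule ccontr)
    assume M1: "infinite M1"
    have "\<forall>n\<in>M1. \<exists>p. (w n)\<^sup>2 \<le> card (\<phi> -` {p} \<inter> block n)" by (simp add: M1_def)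
    then obtain p where p: "\<And>n. n \<in> M1 \<Longrightarrow> (w n)\<^sup>2 \<le> card (\<phi> -` {p n} \<inter> block n)"
      by metis
    have ex: "\<exists>x. x \<in> \<phi> -` {p n} \<inter> block n" if n: "n \<in> M1" for n
    proof (rule ccontr)
      assume "\<nexists>x. x \<in> \<phi> -` {p n} \<inter> block n"
      then have "\<phi> -` {p n} \<inter> block n = {}" by blast
      then show False using p[OF n] block_bound_ge_2[of n] by (simp add: w_def)
    qed
    have "infinite (p ` M1)"
    proof
      assume "finite (p ` M1)"
      then obtain n0 where n0: "infinite {n \<in> M1. p n = p n0}"
        using pigeonhole_infinite[OF M1] by blast
      obtain N where N: "\<phi> -` {p n0} \<subseteq> {..<N}"
        using fin by (meson finite_nat_iff_bounded)
      obtain n where n: "N < n" "n \<in> M1" "p n = p n0"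
        using n0 unfolding infinite_nat_iff_unbounded by blast
      obtain x where "x \<in> \<phi> -` {p n} \<inter> block n" using ex n(2) by blast
      then show False using N n less_block_bound[of n] by (auto simp: block_def)
    qed
    then obtain P where P: "P \<subseteq> p ` M1" "infinite P" "P \<in> block_ideal A"
      by (rule block_ideal_tall)
    have "{n \<in> M1. p n \<in> P} \<subseteq> {n \<in> M. (w n)\<^sup>2 \<le> card (\<phi> -` P \<inter> block n)}"
    proof clarify
      fix n assume n: "n \<in> M1" "p n \<in> P"
      have "card (\<phi> -` {p n} \<inter> block n) \<le> card (\<phi> -` P \<inter> block n)"
        using n(2) by (intro card_mono) auto
      then show "n \<in> M \<and> (w n)\<^sup>2 \<le> card (\<phi> -` P \<inter> block n)"
        using p[OF n(1)] n(1) by (auto simp: M1_def)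
    qed
    then have "finite {n \<in> M1. p n \<in> P}" using key[OF P(3)] finite_subset by blast
    moreover have "P \<subseteq> p ` {n \<in> M1. p n \<in> P}" using P(1) by blast
    ultimately show False using P(2) finite_surj by blast
  qed
  \<comment> \<open>On the remaining blocks all fibres are small, so there are many values.\<close>
  define M2 where "M2 = M - M1"
  have M2: "infinite M2" using M \<open>finite M1\<close> by (simp add: M2_def)
  have "\<exists>Y. Y \<subseteq> \<phi> ` block n - {..<w n} \<and> card Y = (w n)\<^sup>2" if n: "n \<in> M2" for n
  proof -
    have small: "card (\<phi> -` {p} \<inter> block n) \<le> (w n)\<^sup>2" for p
      using n by (auto simp: M2_def M1_def not_le intro: less_imp_le)
    have "block n = (\<Union>p \<in> \<phi> ` block n. \<phi> -` {p} \<inter> block n)" by blast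
    then have "card (block n) \<le> (\<Sum>p \<in> \<phi> ` block n. card (\<phi> -` {p} \<inter> block n))"
      using card_UN_le[of "\<phi> ` block n" "\<lambda>p. \<phi> -` {p} \<inter> block n"] by simp
    also have "\<dots> \<le> card (\<phi> ` block n) * (w n)\<^sup>2"
      using sum_mono[of "\<phi> ` block n", OF small] by simp
    finally have "((w n)\<^sup>2 + w n) * (w n)\<^sup>2 \<le> card (\<phi> ` block n) * (w n)\<^sup>2"
      using card_block_ge[of n] unfolding w_def by (rule order_trans[rotated])
    moreover have "0 < (w n)\<^sup>2" using block_bound_ge_2[of n] by (simp add: w_def)
    ultimately have "(w n)\<^sup>2 + w n \<le> card (\<phi> ` block n)"
      using mult_le_cancel2 by blast
    then have "(w n)\<^sup>2 \<le> card (\<phi> ` block n - {..<w n})"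
      using diff_card_le_card_Diff[of "{..<w n}" "\<phi> ` block n"] by simp
    then show ?thesis by (meson obtain_subset_with_card_n)
  qed
  then obtain Y where Y: "\<And>n. n \<in> M2 \<Longrightarrow> Y n \<subseteq> \<phi> ` block n - {..<w n}"
    "\<And>n. n \<in> M2 \<Longrightarrow> card (Y n) = (w n)\<^sup>2"
    by metis
  define X where "X = (\<Union>n\<in>M2. Y n)"
  have "card (X \<inter> block m) \<le> 2 * growth A m" for m
  proof -
    have Yfin: "finite (Y n)" if "n \<in> M2" for n
      using Y(1)[OF that] by (meson finite_Diff finite_block finite_imageI finite_subset)
    have "X \<inter> block m \<subseteq> (\<Union>n \<in> M2 \<inter> {..m}. Y n)"
    proof
      fix x assume x: "x \<in> X \<inter> block m"
      then obtain n where n: "n \<in> M2" "x \<in> Y n" by (auto simp: X_def)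
      have "n \<le> m"
      proof (rule ccontr)
        assume "\<not> n \<le> m"
        then have "block_bound (Suc m) \<le> w n" by (simp add: w_def block_bound_mono)
        then show False using x n Y(1) by (fastforce simp: block_def)
      qed
      then show "x \<in> (\<Union>n \<in> M2 \<inter> {..m}. Y n)" using n by blast
    qed
    then have "card (X \<inter> block m) \<le> card (\<Union>n \<in> M2 \<inter> {..m}. Y n)"
      using Yfin by (intro card_mono) auto
    also have "\<dots> \<le> (\<Sum>n \<in> M2 \<inter> {..m}. card (Y n))" by (rule card_UN_le) simp
    also have "\<dots> = (\<Sum>n \<in> M2 \<inter> {..m}. (w n)\<^sup>2)" using Y(2) by simp
    also have "\<dots> \<le> 2 * growth A m"
    \<comment> \<open>Only blocks \<open>n \<le> m\<close> contribute to block \<open>m\<close>, and \<open>m\<close> itself contributes only if \<open>m \<in> A\<close>.\<close>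
    proof (cases "m \<in> A")
      case True
      have "(\<Sum>n \<in> M2 \<inter> {..m}. (w n)\<^sup>2) \<le> (\<Sum>n\<le>m. (w n)\<^sup>2)"
        by (rule sum_mono2) auto
      also have "\<dots> = (\<Sum>n<m. (w n)\<^sup>2) + (w m)\<^sup>2"
        by (simp add: lessThan_Suc_atMost[symmetric])
      also have "\<dots> \<le> w m + (w m)\<^sup>2"
        using sum_square_block_bound_le[of m] by (simp add: w_def)
      also have "\<dots> \<le> 2 * growth A m"
        using True block_bound_le_square[of m] by (simp add: growth_def w_def)
      finally show ?thesis .
    next
      case False
      have "n < m" if "n \<in> M2" "n \<le> m" for n
        using that False by (cases "n = m") (auto simp: M2_def M_def)
      then have "(\<Sum>n \<in> M2 \<inter> {..m}. (w n)\<^sup>2) \<le> (\<Sum>n<m. (w n)\<^sup>2)"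
        by (intro sum_mono2) auto
      then show ?thesis
        using sum_square_block_bound_le[of m] block_bound_le_growth[of m A]
        by (simp add: w_def)
    qed
    finally show ?thesis .
  qed
  then have "\<forall>\<^sub>\<infinity>m. card (X \<inter> block m) \<le> 2 * growth A m" by simp
  then have "X \<in> block_ideal A" unfolding block_ideal_def by blast
  then have "finite {n \<in> M. (w n)\<^sup>2 \<le> card (\<phi> -` X \<inter> block n)}" by (rule key)
  moreover have "M2 \<subseteq> {n \<in> M. (w n)\<^sup>2 \<le> card (\<phi> -` X \<inter> block n)}"
  proof clarify
    fix n assume n: "n \<in> M2"
    have "Y n \<subseteq> \<phi> ` (\<phi> -` X \<inter> block n)" using Y(1)[OF n] n unfolding X_def by blast
    then have "card (Y n) \<le> card (\<phi> -` X \<inter> block n)"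
      by (intro surj_card_le) auto
    then show "n \<in> M \<and> (w n)\<^sup>2 \<le> card (\<phi> -` X \<inter> block n)"
      using Y(2)[OF n] n by (simp add: M2_def)
  qed
  ultimately show False using M2 finite_subset by blast
qed

section \<open>Borel complexity\<close>

lemma Sigma0_borel:
  fixes U :: "'a::topological_space set"
  shows "U \<in> Sigma0 n \<Longrightarrow> U \<in> sets borel"
proof (induction n arbitrary: U)
  case (Suc n)
  show ?case
  proof (cases n)
    case (Suc n')
    obtain B :: "nat \<Rightarrow> 'a set" where B: "U = (\<Union>i. B i)" "\<And>i. - B i \<in> Sigma0 n"
      using Suc.prems unfolding Suc Sigma0.simps by blast
    have "B i \<in> sets borel" for i using borel_comp[OF Suc.IH[OF B(2)[of i]]] by simp
    then show ?thesis unfolding B(1) by (intro sets.countable_UN) auto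
  next
    case 0
    then show ?thesis using Suc.prems by simp
  qed
qed simp

text \<open>Any countable index type \<open>'i\<close> may replace the natural numbers in the union.\<close>

lemma Sigma0_SucI:
  assumes "\<And>i::'i. - B i \<in> Sigma0 (Suc n)" "range (e :: nat \<Rightarrow> 'i) = UNIV" "U = (\<Union>i. B i)"
  shows "U \<in> Sigma0 (Suc (Suc n))"
proof -
  have "U = (\<Union>k. B (e k))"
    unfolding assms(3) assms(2)[symmetric] by (rule image_image[THEN arg_cong])
  moreover have "\<forall>k. - B (e k) \<in> Sigma0 (Suc n)" using assms(1) by blast
  ultimately show ?thesis
    unfolding Sigma0.simps mem_Collect_eq by (intro exI[of _ "\<lambda>k. B (e k)"] conjI)
qed

text \<open>The three outer unions merge into one countable union, so the prefix has the shape
  union, intersection, union of closed sets.\<close>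

lemma Sigma0_4_of_closed:
  fixes C :: "nat \<Rightarrow> nat \<Rightarrow> nat \<Rightarrow> nat \<Rightarrow> nat \<Rightarrow> 'a::topological_space set"
  assumes "\<And>c k N n m. closed (C c k N n m)"
  shows "(\<Union>c. \<Union>k. \<Union>N. \<Inter>n. \<Union>m. C c k N n m) \<in> Sigma0 4"
proof -
  have 2: "(\<Union>m. C c k N n m) \<in> Sigma0 (Suc (Suc 0))" for c k N n
    using assms by (auto simp: open_closed)
  have 3: "- (\<Inter>n. \<Union>m. C c k N n m) \<in> Sigma0 (Suc (Suc (Suc 0)))" for c k N
    by (rule Sigma0_SucI[where B = "\<lambda>n. - (\<Union>m. C c k N n m)" and e = id])
      (use 2 in \<open>simp_all only: double_complement, auto\<close>)
  define E where "E = (\<lambda>(c, k, N). \<Inter>n. \<Union>m. C c k N n m)"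
  have "(\<Union>c. \<Union>k. \<Union>N. \<Inter>n. \<Union>m. C c k N n m) \<in> Sigma0 (Suc (Suc (Suc (Suc 0))))"
  proof (rule Sigma0_SucI)
    show "- E i \<in> Sigma0 (Suc (Suc (Suc 0)))" for i
      using 3 by (cases i) (simp only: E_def prod.case)
    show "range (from_nat :: nat \<Rightarrow> nat \<times> nat \<times> nat) = UNIV"
      by simp
    show "(\<Union>c. \<Union>k. \<Union>N. \<Inter>n. \<Union>m. C c k N n m) = (\<Union>i. E i)"
      unfolding E_def by (simp add: UN_Times_distrib set_eq_iff)
  qed
  moreover have "Suc (Suc (Suc (Suc 0))) = 4" by simp
  ultimately show ?thesis by metis
qed

lemma open_coordinate: "open {s :: 'a \<Rightarrow> bool. s p}"
proof -
  have "open ((\<lambda>s :: 'a \<Rightarrow> bool. s p) -` {True})"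
    by (rule open_vimage) (auto intro: open_discrete)
  then show ?thesis by (simp add: vimage_def)
qed

lemma closed_coordinate_imp: "closed {s :: 'a \<Rightarrow> bool. s p \<longrightarrow> Q}"
proof -
  have "open {s :: 'a \<Rightarrow> bool. s p \<and> \<not> Q}" using open_coordinate[of p] by (cases Q) auto
  then show ?thesis by (simp add: closed_def Collect_neg_eq[symmetric])
qed

lemma open_all_finite:
  assumes "finite F" "\<And>x. x \<in> F \<Longrightarrow> open {s. Q x s}"
  shows "open {s. \<forall>x\<in>F. Q x s}"
proof -
  have "{s. \<forall>x\<in>F. Q x s} = (\<Inter>x\<in>F. {s. Q x s})" by auto
  then show ?thesis using assms by (auto intro: open_INT)
qed

text \<open>Violating the bound is witnessed by finitely many points of the column.\<close>

lemma open_big_column: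
  "open {s :: nat \<times> nat \<Rightarrow> bool. n \<in> big_columns c (Collect s)}"
proof -
  have *: "n \<in> big_columns c (Collect s) \<longleftrightarrow> (\<exists>F. finite F \<and> card F = Suc c \<and> (\<forall>i\<in>F. s (n, i)))"
    (is "?L \<longleftrightarrow> ?R") for s :: "nat \<times> nat \<Rightarrow> bool"
  proof
    let ?S = "Collect s `` {n}"
    assume ?L
    have "\<exists>F. finite F \<and> card F = Suc c \<and> F \<subseteq> ?S"
    proof (cases "finite ?S")
      case True
      then have "Suc c \<le> card ?S" using \<open>?L\<close> by (simp add: big_columns_def)
      then obtain F where "F \<subseteq> ?S" "card F = Suc c" "finite F"
        by (rule obtain_subset_with_card_n)
      then show ?thesis by blast
    qed (rule infinite_arbitrarily_large)
    then obtain F where "finite F" "card F = Suc c" "F \<subseteq> ?S" by blast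
    then show ?R by (intro exI[of _ F]) auto
  next
    let ?S = "Collect s `` {n}"
    assume ?R
    then obtain F where F: "finite F" "card F = Suc c" "\<forall>i\<in>F. s (n, i)" by blast
    then have "F \<subseteq> ?S" by auto
    then have "finite ?S \<Longrightarrow> c < card ?S" using card_mono[of ?S F] F(2) by simp
    then show ?L by (auto simp: big_columns_def)
  qed
  have "{s. n \<in> big_columns c (Collect s)} =
      (\<Union>F\<in>{F. finite F \<and> card F = Suc c}. {s. \<forall>i\<in>F. s (n, i)})"
    unfolding * by (simp add: set_eq_iff)
  moreover have "open \<dots>"
    by (intro open_UN ballI open_all_finite open_coordinate) simp
  ultimately show ?thesis by simp
qed

lemma closed_card_big_columns:
  assumes "finite I"
  shows "closed {s :: nat \<times> nat \<Rightarrow> bool. card (big_columns c (Collect s) \<inter> I) \<le> K}"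
proof -
  have *: "\<not> card (big_columns c (Collect s) \<inter> I) \<le> K \<longleftrightarrow>
      (\<exists>T\<in>{T. T \<subseteq> I \<and> K < card T}. \<forall>x\<in>T. x \<in> big_columns c (Collect s))"
    (is "?L \<longleftrightarrow> ?R") for s :: "nat \<times> nat \<Rightarrow> bool"
  proof
    assume ?R
    then obtain T where "T \<subseteq> big_columns c (Collect s) \<inter> I" "K < card T" by blast
    then show ?L using assms by (meson card_mono finite_Int leD le_trans)
  next
    assume ?L
    then show ?R by (intro bexI[of _ "big_columns c (Collect s) \<inter> I"]) auto
  qed
  have "- {s :: nat \<times> nat \<Rightarrow> bool. card (big_columns c (Collect s) \<inter> I) \<le> K} =
      (\<Union>T\<in>{T. T \<subseteq> I \<and> K < card T}. {s. \<forall>x\<in>T. x \<in> big_columns c (Collect s)})"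
    using * by (auto simp: Collect_neg_eq[symmetric])
  moreover have "open \<dots>"
    using assms by (intro open_UN ballI open_all_finite open_big_column) (auto intro: finite_subset)
  ultimately show ?thesis by (simp add: closed_def)
qed

text \<open>Membership reads: there are \<open>c\<close>, \<open>k\<close> and \<open>N\<close> such that, for all \<open>n \<ge> N\<close>, column \<open>n\<close> is bounded by
  some \<open>m\<close> and block \<open>n\<close> contains at most \<open>k * growth A n\<close> columns with more than \<open>c\<close> points.
  The matrix is closed, because exceeding one of these bounds is witnessed by finitely many points.\<close>

lemma Sigma0_block_column_ideal: "Sigma0_ideal 4 (column_ideal (block_ideal A))"
proof -
  define C where "C c k N n m = {s :: nat \<times> nat \<Rightarrow> bool. n < N \<or>
      ((\<forall>i. s (n, i) \<longrightarrow> i < m) \<and> card (big_columns c (Collect s) \<inter> block n) \<le> k * growth A n)}"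
    for c k N n m :: nat
  have cl: "closed (C c k N n m)" for c k N n m
  proof (cases "n < N")
    case False
    have "closed {s :: nat \<times> nat \<Rightarrow> bool. \<forall>i. s (n, i) \<longrightarrow> i < m}"
      by (intro closed_Collect_all closed_coordinate_imp)
    moreover have "C c k N n m = {s. \<forall>i. s (n, i) \<longrightarrow> i < m} \<inter>
        {s. card (big_columns c (Collect s) \<inter> block n) \<le> k * growth A n}"
      using False by (auto simp: C_def)
    ultimately show ?thesis using closed_card_big_columns[OF finite_block] by auto
  qed (simp add: C_def)
  have "Collect -` column_ideal (block_ideal A) = (\<Union>c. \<Union>k. \<Union>N. \<Inter>n. \<Union>m. C c k N n m)"
  proof (intro set_eqI iffI)
    fix s :: "nat \<times> nat \<Rightarrow> bool"
    assume "s \<in> Collect -` column_ideal (block_ideal A)"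
    then obtain c k where fin: "\<forall>\<^sub>\<infinity>n. finite (Collect s `` {n})"
      and k: "\<forall>\<^sub>\<infinity>n. card (big_columns c (Collect s) \<inter> block n) \<le> k * growth A n"
      by (auto simp: column_ideal_def block_ideal_def)
    from MOST_conjI[OF fin k] obtain N where
      N: "\<And>n. N \<le> n \<Longrightarrow> finite (Collect s `` {n}) \<and> card (big_columns c (Collect s) \<inter> block n) \<le> k * growth A n"
      unfolding MOST_nat_le by blast
    have "\<exists>m. s \<in> C c k N n m" for n
    proof (cases "n < N")
      case False
      then obtain m where "Collect s `` {n} \<subseteq> {..<m}" using N[of n] finite_nat_iff_bounded by auto
      then show ?thesis using N[of n] False by (auto simp: C_def subset_iff)
    qed (simp add: C_def)
    then have "\<exists>c k N. \<forall>n. \<exists>m. s \<in> C c k N n m" by blast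
    then show "s \<in> (\<Union>c. \<Union>k. \<Union>N. \<Inter>n. \<Union>m. C c k N n m)" by simp
  next
    fix s :: "nat \<times> nat \<Rightarrow> bool"
    assume "s \<in> (\<Union>c. \<Union>k. \<Union>N. \<Inter>n. \<Union>m. C c k N n m)"
    then have "\<exists>c k N. \<forall>n. \<exists>m. s \<in> C c k N n m" by simp
    then obtain c k N where s: "\<And>n. \<exists>m. s \<in> C c k N n m" by blast
    have "finite (Collect s `` {n}) \<and> card (big_columns c (Collect s) \<inter> block n) \<le> k * growth A n"
      if n: "N \<le> n" for n
    proof -
      obtain m where m: "s \<in> C c k N n m" using s by blast
      then have "Collect s `` {n} \<subseteq> {..<m}" using n by (auto simp: C_def)
      then show ?thesis using m n finite_subset by (auto simp: C_def)
    qed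
    then have "\<forall>\<^sub>\<infinity>n. finite (Collect s `` {n})"
      "\<forall>\<^sub>\<infinity>n. card (big_columns c (Collect s) \<inter> block n) \<le> k * growth A n"
      unfolding MOST_nat_le by blast+
    then show "s \<in> Collect -` column_ideal (block_ideal A)"
      by (auto simp: column_ideal_def block_ideal_def)
  qed
  then show ?thesis
    using Sigma0_4_of_closed[of C, OF cl] column_ideal_ideal[OF block_ideal_ideal]
    by (simp add: Sigma0_ideal_def del: Sigma0.simps)
qed

section \<open>Antichains and chains in the power set modulo finite sets\<close>

text \<open>The classical almost disjoint family of branches: \<open>D x\<close> codes the finite initial segments of
  \<open>x\<close>, and initial segments of distinct sets differ from some length on.\<close>

lemma almost_incomparable_family:
  obtains D :: "nat set \<Rightarrow> nat set" where "\<And>x y. x \<noteq> y \<Longrightarrow> \<not> D x \<subseteq>\<^sup>* D y"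
proof
  define D where "D x = range (\<lambda>n. prod_encode (n, set_encode (x \<inter> {..<n})))" for x :: "nat set"
  fix x y :: "nat set" assume "x \<noteq> y"
  then obtain a where a: "a \<in> x \<longleftrightarrow> a \<notin> y" by blast
  define g where "g n = prod_encode (n, set_encode (x \<inter> {..<n}))" for n
  have "g n \<in> D x - D y" if n: "a < n" for n
  proof -
    have "x \<inter> {..<n} \<noteq> y \<inter> {..<n}" using a n by blast
    then have "set_encode (x \<inter> {..<n}) \<noteq> set_encode (y \<inter> {..<n})"
      by (simp add: set_encode_eq)
    then show ?thesis by (auto simp: D_def g_def prod_encode_eq)
  qed
  then have "g ` {a<..} \<subseteq> D x - D y" by auto
  moreover have "infinite (g ` {a<..})"
    using finite_imageD[of g "{a<..}"] infinite_Ioi[of a] by (auto simp: g_def inj_on_def prod_encode_eq)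
  ultimately show "\<not> D x \<subseteq>\<^sup>* D y" unfolding almost_subset_def using finite_subset by blast
qed

definition undergraph :: "(nat \<Rightarrow> nat) \<Rightarrow> nat set" where
  "undergraph f = {prod_encode (n, i) | n i. i \<le> f n}"

text \<open>For each \<open>n\<close> the difference of the undergraphs has the finitely many points from \<open>g n + 1\<close> to
  \<open>f n\<close>, at least one if \<open>g n < f n\<close>. So it is finite iff there are finitely many such \<open>n\<close>.\<close>

lemma undergraph_almost_subset_iff: "undergraph f \<subseteq>\<^sup>* undergraph g \<longleftrightarrow> f \<le>\<^sup>* g"
proof -
  define D where "D = (SIGMA n:{n. \<not> f n \<le> g n}. {g n<..f n})"
  have "undergraph f - undergraph g = prod_encode ` D"
    by (auto simp: undergraph_def D_def image_iff prod_encode_eq not_le)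
  then have "undergraph f \<subseteq>\<^sup>* undergraph g \<longleftrightarrow> finite D"
    using finite_image_iff[OF inj_prod_encode[of D]] by (simp add: almost_subset_def)
  also have "\<dots> \<longleftrightarrow> finite {n. \<not> f n \<le> g n}"
  proof
    have "fst ` D = {n. \<not> f n \<le> g n}" by (force simp: D_def)
    then show "finite D \<Longrightarrow> finite {n. \<not> f n \<le> g n}" by (metis finite_imageI)
  qed (auto simp: D_def intro!: finite_SigmaI)
  finally show ?thesis by (simp add: eventually_le_def eventually_cofinite)
qed

text \<open>Recursion along \<open>\<bb>\<close>: an initial segment has fewer than \<open>\<bb>\<close> elements, so the functions chosen so far have
  a common bound \<open>g\<close> with respect to \<open>\<le>\<^sup>*\<close>, and the next function is \<open>g + 1\<close>. Adding \<open>1\<close> makes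
  the chain strict.\<close>

lemma eventually_increasing_chain:
  obtains f :: "(nat \<Rightarrow> nat) \<Rightarrow> nat \<Rightarrow> nat"
  where "\<And>\<alpha> \<beta>. (\<alpha>, \<beta>) \<in> \<bb> \<Longrightarrow> \<alpha> \<noteq> \<beta> \<Longrightarrow> f \<alpha> \<le>\<^sup>* f \<beta> \<and> \<not> f \<beta> \<le>\<^sup>* f \<alpha>"
proof -
  define step where "step F \<alpha> n = Suc ((SOME g. \<forall>\<beta>\<in>underS \<bb> \<alpha>. F \<beta> \<le>\<^sup>* g) n)"
    for F :: "(nat \<Rightarrow> nat) \<Rightarrow> nat \<Rightarrow> nat" and \<alpha> n
  define f where "f = wfrec (\<bb> - Id) step"
  have f: "f \<alpha> n = Suc ((SOME g. \<forall>\<beta>\<in>underS \<bb> \<alpha>. f \<beta> \<le>\<^sup>* g) n)" for \<alpha> n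
  proof -
    have "f \<alpha> = step (cut f (\<bb> - Id) \<alpha>) \<alpha>"
      unfolding f_def 
      using wo_rel.WF[OF Card_order_wo_rel[OF bounding_number_Card_order]] by (rule wfrec)
    moreover have "cut f (\<bb> - Id) \<alpha> \<beta> = f \<beta>" if "\<beta> \<in> underS \<bb> \<alpha>" for \<beta>
      using that by (auto simp: underS_def cut_apply)
    ultimately show ?thesis by (simp add: step_def cong: ball_cong)
  qed
  show ?thesis
  proof (rule that)
    fix \<alpha> \<beta> assume \<alpha>\<beta>: "(\<alpha>, \<beta>) \<in> \<bb>" "\<alpha> \<noteq> \<beta>"
    define g where "g = (SOME g. \<forall>\<gamma>\<in>underS \<bb> \<beta>. f \<gamma> \<le>\<^sup>* g)"
    have "|underS \<bb> \<beta>| <o \<bb>"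
      using \<alpha>\<beta>(1) by (intro card_of_underS bounding_number_Card_order FieldI2)
    then have "|f ` underS \<bb> \<beta>| <o \<bb>"
      using card_of_image ordLeq_ordLess_trans by blast
    then have "\<not> unbounded_family (f ` underS \<bb> \<beta>)"
      using bounding_number_least not_ordLess_ordLeq by blast
    then have "\<exists>g. \<forall>\<gamma>\<in>underS \<bb> \<beta>. f \<gamma> \<le>\<^sup>* g"
      by (auto simp: unbounded_family_def)
    then have "\<forall>\<gamma>\<in>underS \<bb> \<beta>. f \<gamma> \<le>\<^sup>* g" unfolding g_def by (rule someI_ex)
    then have le: "\<forall>\<^sub>\<infinity>n. f \<alpha> n \<le> g n"
      using \<alpha>\<beta> by (auto simp: underS_def eventually_le_def)
    have \<beta>: "f \<beta> n = Suc (g n)" for n by (simp add: f[of \<beta>] g_def)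
    have "f \<alpha> \<le>\<^sup>* f \<beta>"
      unfolding eventually_le_def using le by (rule MOST_mono) (simp add: \<beta>)
    moreover have "\<not> f \<beta> \<le>\<^sup>* f \<alpha>"
    proof
      assume "f \<beta> \<le>\<^sup>* f \<alpha>"
      then have "\<forall>\<^sub>\<infinity>n. f \<beta> n \<le> f \<alpha> n" by (simp add: eventually_le_def)
      from MOST_conjI[OF this le] have "\<forall>\<^sub>\<infinity>n::nat. False"
        by (rule MOST_mono) (auto simp: \<beta>)
      then show False by simp
    qed
    ultimately show "f \<alpha> \<le>\<^sup>* f \<beta> \<and> \<not> f \<beta> \<le>\<^sup>* f \<alpha>" ..
  qed
qed

lemma almost_subset_Compl_iff: "- A \<subseteq>\<^sup>* - B \<longleftrightarrow> B \<subseteq>\<^sup>* A"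
  by (simp add: almost_subset_def Diff_eq Int_commute)

section \<open>The embedding\<close>

lemma ideal_isomorphic_imp_katetov: "ideal_isomorphic \<I> \<J> \<Longrightarrow> \<I> \<le>\<^sub>K \<J>"
proof -
  assume "ideal_isomorphic \<I> \<J>"
  then obtain f where f: "bij f" "\<And>A. A \<in> \<I> \<Longrightarrow> f ` A \<in> \<J>"
    by (auto simp: ideal_isomorphic_def)
  have "inv f -` A = f ` A" for A
    using bij_vimage_eq_inv_image[OF bij_imp_bij_inv[OF f(1)]] inv_inv_eq[OF f(1)] by simp
  then show "\<I> \<le>\<^sub>K \<J>" unfolding katetov_le_def using f(2) by (intro exI[of _ "inv f"]) simp
qed

theorem theorem5p5:
  shows
    "(\<exists>\<F> :: nat set \<Rightarrow> (nat \<Rightarrow> nat) set.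
        \<F> respects eq_mod_fin \<and>
        (\<forall>A. \<F> A \<noteq> {} \<and>
             Borel_ideal (family_ideal (\<F> A)) \<and>
             Sigma0_ideal 4 (family_ideal (\<F> A)) \<and>
             ED \<le>\<^sub>K family_ideal (\<F> A) \<and>
             family_ideal (\<F> A) \<le>\<^sub>K FinFin) \<and>
        (\<forall>A B. (A \<subseteq>\<^sup>* B \<longleftrightarrow> family_ideal (\<F> A) \<le>\<^sub>K family_ideal (\<F> B)) \<and>
               (family_ideal (\<F> A) \<le>\<^sub>K family_ideal (\<F> B) \<longleftrightarrow>
                family_ideal (\<F> A) \<le>\<^sub>K\<^sub>B family_ideal (\<F> B)))) \<and>
     (\<exists>\<A> :: (nat \<times> nat) set set set.
        |\<A>| =o |UNIV :: nat set set| \<and>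
        (\<forall>\<I>\<in>\<A>. Borel_family_ideal \<I>) \<and>
        pairwise (\<lambda>\<I> \<J>. \<not> \<I> \<le>\<^sub>K \<J> \<and> \<not> \<J> \<le>\<^sub>K \<I>) \<A>) \<and>
     (\<exists>\<A> :: (nat \<times> nat) set set set.
        |\<A>| =o |UNIV :: nat set set| \<and>
        (\<forall>\<I>\<in>\<A>. Borel_family_ideal \<I>) \<and>
        pairwise (\<lambda>\<I> \<J>. \<not> ideal_isomorphic \<I> \<J>) \<A>) \<and>
     (\<exists>\<I> :: (nat \<Rightarrow> nat) \<Rightarrow> (nat \<times> nat) set set.
        (\<forall>\<alpha>\<in>Field \<bb>. Borel_family_ideal (\<I> \<alpha>)) \<and>
        (\<forall>\<alpha> \<beta>. (\<alpha>, \<beta>) \<in> \<bb> \<and> \<alpha> \<noteq> \<beta> \<longrightarrow> \<I> \<alpha> \<le>\<^sub>K\<^sub>B \<I> \<beta> \<and> \<not> \<I> \<beta> \<le>\<^sub>K\<^sub>B \<I> \<alpha>)) \<and>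
     (\<exists>\<I> :: (nat \<Rightarrow> nat) \<Rightarrow> (nat \<times> nat) set set.
        (\<forall>\<alpha>\<in>Field \<bb>. Borel_family_ideal (\<I> \<alpha>)) \<and>
        (\<forall>\<alpha> \<beta>. (\<alpha>, \<beta>) \<in> \<bb> \<and> \<alpha> \<noteq> \<beta> \<longrightarrow> \<I> \<beta> \<le>\<^sub>K\<^sub>B \<I> \<alpha> \<and> \<not> \<I> \<alpha> \<le>\<^sub>K\<^sub>B \<I> \<beta>))"
proof -
  define \<F> where "\<F> A = column_functions (block_ideal A)" for A
  define I where "I A = column_ideal (block_ideal A)" for A
  have I: "family_ideal (\<F> A) = I A" for A
    by (simp add: \<F>_def I_def family_ideal_column_functions block_ideal_ideal)
  have KB: "A \<subseteq>\<^sup>* B \<Longrightarrow> I A \<le>\<^sub>K\<^sub>B I B" for A B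
    unfolding I_def by (intro column_ideal_katetov_blass_mono block_ideal_katetov_blass_mono)
  have K: "I A \<le>\<^sub>K I B \<Longrightarrow> A \<subseteq>\<^sup>* B" for A B
    unfolding I_def
    by (intro block_ideal_reflect column_ideal_katetov_reflect block_ideal_ideal)
  have K_iff: "I A \<le>\<^sub>K I B \<longleftrightarrow> A \<subseteq>\<^sup>* B" and KB_iff: "I A \<le>\<^sub>K\<^sub>B I B \<longleftrightarrow> A \<subseteq>\<^sup>* B" for A B
    using K KB katetov_blass_imp_katetov by blast+
  have ne: "\<F> A \<noteq> {}" for A
  proof -
    have "(\<lambda>_. 0) \<in> \<F> A"
      using ideal_finite[OF block_ideal_ideal] by (simp add: \<F>_def column_functions_def)
    then show ?thesis by blast
  qed
  have Sigma: "Sigma0_ideal 4 (I A)" for A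
    unfolding I_def by (rule Sigma0_block_column_ideal)
  have Borel: "Borel_ideal (I A)" for A
    using Sigma[of A] Sigma0_borel[of "Collect -` I A" 4]
    by (simp add: Borel_ideal_def Sigma0_ideal_def del: Sigma0.simps)
  have BF: "Borel_family_ideal (I A)" for A
    unfolding Borel_family_ideal_def using Borel[of A] ne[of A] I[of A, symmetric] by blast
  have resp: "\<F> respects eq_mod_fin"
  proof (rule congruentI)
    fix A B :: "nat set" assume "(A, B) \<in> eq_mod_fin"
    then have "block_ideal A = block_ideal B"
      by (intro equalityI block_ideal_mono) (simp_all add: eq_mod_fin_def)
    then show "\<F> A = \<F> B" by (simp add: \<F>_def)
  qed
  have ED: "ED \<le>\<^sub>K I A" and FF: "I A \<le>\<^sub>K FinFin" for A
    unfolding I_def by (simp_all add: ED_le_column_ideal block_ideal_ideal column_ideal_le_FinFin)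
  obtain D :: "nat set \<Rightarrow> nat set" where D: "\<And>x y. x \<noteq> y \<Longrightarrow> \<not> D x \<subseteq>\<^sup>* D y"
    using almost_incomparable_family by blast
  have refl: "A \<subseteq>\<^sup>* A" for A :: "nat set" by (simp add: almost_subset_def)
  define \<A> where "\<A> = range (\<lambda>x. I (D x))"
  have "inj (\<lambda>x. I (D x))"
  proof (rule injI, rule ccontr)
    fix x y assume "I (D x) = I (D y)" "x \<noteq> y"
    then show False using K_iff[of "D x" "D x"] K_iff[of "D x" "D y"] refl D by simp
  qed
  then have card: "|\<A>| =o |UNIV :: nat set set|"
    unfolding \<A>_def by (intro ordIso_symmetric[OF card_of_ordIsoI[OF inj_on_imp_bij_betw]])
  have anti: "pairwise (\<lambda>\<I> \<J>. \<not> \<I> \<le>\<^sub>K \<J> \<and> \<not> \<J> \<le>\<^sub>K \<I>) \<A>"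
  proof (rule pairwiseI)
    fix \<I> \<J> assume "\<I> \<in> \<A>" "\<J> \<in> \<A>" "\<I> \<noteq> \<J>"
    then obtain x y where "\<I> = I (D x)" "\<J> = I (D y)" "x \<noteq> y" by (auto simp: \<A>_def)
    then show "\<not> \<I> \<le>\<^sub>K \<J> \<and> \<not> \<J> \<le>\<^sub>K \<I>"
      using D[of x y] D[of y x] by (simp add: K_iff)
  qed
  then have iso: "pairwise (\<lambda>\<I> \<J>. \<not> ideal_isomorphic \<I> \<J>) \<A>"
    unfolding pairwise_def using ideal_isomorphic_imp_katetov by blast
  have BA: "\<forall>\<I>\<in>\<A>. Borel_family_ideal \<I>" using BF by (auto simp: \<A>_def)
  obtain f :: "(nat \<Rightarrow> nat) \<Rightarrow> nat \<Rightarrow> nat" where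
    f: "\<And>\<alpha> \<beta>. (\<alpha>, \<beta>) \<in> \<bb> \<Longrightarrow> \<alpha> \<noteq> \<beta> \<Longrightarrow> f \<alpha> \<le>\<^sup>* f \<beta> \<and> \<not> f \<beta> \<le>\<^sup>* f \<alpha>"
    using eventually_increasing_chain by blast
  show ?thesis
  proof (intro conjI)
    show "\<exists>\<F> :: nat set \<Rightarrow> (nat \<Rightarrow> nat) set.
        \<F> respects eq_mod_fin \<and>
        (\<forall>A. \<F> A \<noteq> {} \<and>
             Borel_ideal (family_ideal (\<F> A)) \<and>
             Sigma0_ideal 4 (family_ideal (\<F> A)) \<and>
             ED \<le>\<^sub>K family_ideal (\<F> A) \<and>
             family_ideal (\<F> A) \<le>\<^sub>K FinFin) \<and>
        (\<forall>A B. (A \<subseteq>\<^sup>* B \<longleftrightarrow> family_ideal (\<F> A) \<le>\<^sub>K family_ideal (\<F> B)) \<and>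
               (family_ideal (\<F> A) \<le>\<^sub>K family_ideal (\<F> B) \<longleftrightarrow>
                family_ideal (\<F> A) \<le>\<^sub>K\<^sub>B family_ideal (\<F> B)))"
      by (intro exI[of _ \<F>]) (simp add: I resp ne Borel Sigma ED FF K_iff KB_iff)
  next
    show "\<exists>\<I> :: (nat \<Rightarrow> nat) \<Rightarrow> (nat \<times> nat) set set.
        (\<forall>\<alpha>\<in>Field \<bb>. Borel_family_ideal (\<I> \<alpha>)) \<and>
        (\<forall>\<alpha> \<beta>. (\<alpha>, \<beta>) \<in> \<bb> \<and> \<alpha> \<noteq> \<beta> \<longrightarrow> \<I> \<alpha> \<le>\<^sub>K\<^sub>B \<I> \<beta> \<and> \<not> \<I> \<beta> \<le>\<^sub>K\<^sub>B \<I> \<alpha>)"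
      using f by (intro exI[of _ "\<lambda>\<alpha>. I (undergraph (f \<alpha>))"])
        (simp add: BF KB_iff undergraph_almost_subset_iff)
  next
    show "\<exists>\<I> :: (nat \<Rightarrow> nat) \<Rightarrow> (nat \<times> nat) set set.
        (\<forall>\<alpha>\<in>Field \<bb>. Borel_family_ideal (\<I> \<alpha>)) \<and>
        (\<forall>\<alpha> \<beta>. (\<alpha>, \<beta>) \<in> \<bb> \<and> \<alpha> \<noteq> \<beta> \<longrightarrow> \<I> \<beta> \<le>\<^sub>K\<^sub>B \<I> \<alpha> \<and> \<not> \<I> \<alpha> \<le>\<^sub>K\<^sub>B \<I> \<beta>)"
      using f by (intro exI[of _ "\<lambda>\<alpha>. I (- undergraph (f \<alpha>))"])
        (simp add: BF KB_iff almost_subset_Compl_iff undergraph_almost_subset_iff)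
  qed (rule exI[of _ \<A>], simp add: card BA anti iso)+
qed

end
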